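(* Let $S=\sum_{i=1}^n X_i$ be a sum of continuous random variables $X_1,\dots,X_n$, and let $T$ be a continuous comonotonic approximation of $S$, meaning that there exist continuous random variables $Y_1,\dots,Y_n$ such that $T=Y_1^c+\dots+Y_n^c$. Let $r$ be a positive integer such that the moments $E[S^r]$ and $E[T^r]$ exist, and put $c=(1,E[S],\dots,E[S^r])'$. Let $Q=(q_1,\dots,q_m)'$ be any fixed numerical vector with $0=q_0<q_1<q_2<\dots<q_m=1$, and define the $(r+1)$-dimensional column vectors $$b_j=(1,b_{1j},\dots,b_{rj})',\qquad b_{ij}=E\big[T^i\,\big|\,F_T^{-1}(q_{j-1})\le T\le F_T^{-1}(q_j)\big]<\infty,\qquad i=1,\dots,r,\ j=1,\dots,m.$$ Let $\mathrm{Cone}(b_1,\dots,b_m)=\big\{\sum_{j=1}^m\lambda_jb_j : \lambda_j\ge 0,\ j=1,\dots,m\big\}$. If $c\in\mathrm{Cone}(b_1,\dots,b_m)$, then one can find a comonotonic approximation $T_\omega$ of $S$, namely a step-weighted version $T_\omega=T_{A,Q}$ of $T$ associated with some numerical vector $A=(a_1,\dots,a_m)'$ with $\min(a_1,\dots,a_m)\ge 0$, $\max(a_1,\dots,a_m)>0$, and with the given $Q$, such that $$E[(T_\omega)^i]=E[S^i],\qquad i=1,\dots,r.$$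
   Context: A random variable $X$ is called continuous if its distribution function $F_X(x)=P(X\le x)$ is continuous on $\mathbb R$. For a distribution function $F$ and $p\in[0,1]$: $F^{-1}(p)=\inf\{x\in\mathbb R: F(x)\ge p\}$ and $F^{-1+}(p)=\sup\{x\in\mathbb R: F(x)\le p\}$, with $\inf\emptyset=+\infty$, $\sup\emptyset=-\infty$, $\inf\mathbb R=-\infty$, $\sup\mathbb R=+\infty$. A random vector $(Z_1,\dots,Z_n)$ is comonotonic if it has the same distribution as $(F_{Z_1}^{-1}(U),\dots,F_{Z_n}^{-1}(U))$ with $U$ uniform on $(0,1)$. For random variables $Y_1,\dots,Y_n$, $(Y_1^c,\dots,Y_n^c)$ denotes a comonotonic modification: a comonotonic random vector with the same marginal distributions as $(Y_1,\dots,Y_n)$; the sum $Y_1^c+\dots+Y_n^c$ is called a comonotonic sum. A comonotonic approximation of $S$ is a random variable that is equal in distribution to a comonotonic sum $Z_1^c+\dots+Z_n^c$ for some random variables $Z_1,\dots,Z_n$ ("approximation" carries no further quantitative meaning). Step-weighting: let $A=(a_1,\dots,a_m)'$, $Q=(q_1,\dots,q_m)'$ with $\min_i a_i\ge0$, $\max_i a_i>0$, $0=q_0<q_1<\dots<q_m=1$. For a continuous random variable $X$, the step-weight function $\omega_{A,Q}=\omega_{A,Q,X}:\mathbb R\to[0,\infty)$ is: $a_1$ for $F_X^{-1+}(q_0)\le x<F_X^{-1}(q_1)$; $a_k$ for $F_X^{-1}(q_{k-1})\le x<F_X^{-1}(q_k)$, $k=2,\dots,m-1$; $a_m$ for $F_X^{-1}(q_{m-1})\le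 x\le F_X^{-1}(q_m)$; and $0$ otherwise (for $m=1$ it is $a_1$ on $F_X^{-1+}(0)\le x\le F_X^{-1}(1)$, and $0$ otherwise). The step-weighted version $X_{A,Q}$ (also written $X_\omega$ with $\omega=\omega_{A,Q,X}$) is a random variable with distribution function determined by $dF_{X_{A,Q}}(x)=\frac{\omega_{A,Q}(x)}{E[\omega_{A,Q}(X)]}\,dF_X(x)$. "The moment $E[Z^r]$ exists" means $E[|Z|^r]<\infty$. *)

theory Defs
  imports "HOL-Probability.Probability"
begin

definition continuous_rv :: "'a measure \<Rightarrow> ('a \<Rightarrow> real) \<Rightarrow> bool" where
  "continuous_rv M X \<longleftrightarrow>
     X \<in> borel_measurable M \<and> continuous_on UNIV (cdf (distr M borel X))"

text \<open>The two generalised inverses of a distribution function take values in the extended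
  reals, where \<open>Inf {} = \<infinity>\<close>, \<open>Sup {} = -\<infinity>\<close>, and the infimum and supremum of the whole real
  line are \<open>-\<infinity>\<close> and \<open>\<infinity>\<close>.\<close>

definition quantile :: "(real \<Rightarrow> real) \<Rightarrow> real \<Rightarrow> ereal" where
  "quantile F p = (INF x\<in>{x. F x \<ge> p}. ereal x)"

definition upper_quantile :: "(real \<Rightarrow> real) \<Rightarrow> real \<Rightarrow> ereal" where
  "upper_quantile F p = (SUP x\<in>{x. F x \<le> p}. ereal x)"

text \<open>A random vector is a family indexed by \<open>{1..n}\<close>. The uniform variable \<open>U\<close> is the identity
  on the real line under the uniform measure on \<open>{0<..<1}\<close>; there the quantiles of a real random
  variable are finite, so \<open>real_of_ereal\<close> loses nothing.\<close>

definition comonotonic :: "nat \<Rightarrow> 'a measure \<Rightarrow> (nat \<Rightarrow> 'a \<Rightarrow> real) \<Rightarrow> bool" where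
  "comonotonic n M Z \<longleftrightarrow>
     (\<forall>i\<in>{1..n}. Z i \<in> borel_measurable M) \<and>
     distr M (\<Pi>\<^sub>M i\<in>{1..n}. borel) (\<lambda>\<omega>. \<lambda>i\<in>{1..n}. Z i \<omega>) =
     distr (uniform_measure lborel {0<..<1::real}) (\<Pi>\<^sub>M i\<in>{1..n}. borel)
       (\<lambda>u. \<lambda>i\<in>{1..n}. real_of_ereal (quantile (cdf (distr M borel (Z i))) u))"

text \<open>\<open>Yc\<close> may live on a different probability space than \<open>Y\<close>.\<close>

definition comonotonic_modification ::
  "nat \<Rightarrow> 'a measure \<Rightarrow> (nat \<Rightarrow> 'a \<Rightarrow> real) \<Rightarrow> 'b measure \<Rightarrow> (nat \<Rightarrow> 'b \<Rightarrow> real) \<Rightarrow> bool" where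
  "comonotonic_modification n M Y N Yc \<longleftrightarrow>
     prob_space M \<and> (\<forall>i\<in>{1..n}. Y i \<in> borel_measurable M) \<and>
     prob_space N \<and> comonotonic n N Yc \<and>
     (\<forall>i\<in>{1..n}. distr N borel (Yc i) = distr M borel (Y i))"

text \<open>\<open>T\<close> is a comonotonic approximation of a sum of \<open>n\<close> random variables; the notion depends on
  that sum only through \<open>n\<close>. Since only marginal laws matter, the witnesses can be taken on
  probability spaces over the reals.\<close>

definition comonotonic_approximation :: "nat \<Rightarrow> 'a measure \<Rightarrow> ('a \<Rightarrow> real) \<Rightarrow> bool" where
  "comonotonic_approximation n M T \<longleftrightarrow>
     T \<in> borel_measurable M \<and>
     (\<exists>(N :: real measure) Z (N' :: real measure) Zc.
        comonotonic_modification n N Z N' Zc \<and>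
        distr M borel T = distr N' borel (\<lambda>\<omega>. \<Sum>i=1..n. Zc i \<omega>))"

text \<open>The vectors \<open>A\<close> and \<open>Q\<close> are the values of \<open>a\<close> on \<open>{1..m}\<close> and of \<open>q\<close> on \<open>{0..m}\<close>.
  For increasing \<open>q\<close> the steps are pairwise disjoint, so at most one summand of
  \<open>step_weight\<close> is nonzero.\<close>

definition step :: "(real \<Rightarrow> real) \<Rightarrow> nat \<Rightarrow> (nat \<Rightarrow> real) \<Rightarrow> nat \<Rightarrow> real set" where
  "step F m q k =
     {x. (if k = 1 then upper_quantile F (q 0) else quantile F (q (k - 1))) \<le> ereal x \<and>
         (if k = m then ereal x \<le> quantile F (q m) else ereal x < quantile F (q k))}"

definition step_weight ::
  "'a measure \<Rightarrow> ('a \<Rightarrow> real) \<Rightarrow> nat \<Rightarrow> (nat \<Rightarrow> real) \<Rightarrow> (nat \<Rightarrow> real) \<Rightarrow> real \<Rightarrow> real" where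
  "step_weight M X m a q x =
     (\<Sum>k=1..m. a k * indicator (step (cdf (distr M borel X)) m q k) x)"

definition step_weighted_version ::
  "'a measure \<Rightarrow> ('a \<Rightarrow> real) \<Rightarrow> nat \<Rightarrow> (nat \<Rightarrow> real) \<Rightarrow> (nat \<Rightarrow> real) \<Rightarrow>
   'b measure \<Rightarrow> ('b \<Rightarrow> real) \<Rightarrow> bool" where
  "step_weighted_version M X m a q N W \<longleftrightarrow>
     W \<in> borel_measurable N \<and>
     distr N borel W =
       density (distr M borel X)
         (\<lambda>x. ennreal (step_weight M X m a q x / (\<integral>\<omega>. step_weight M X m a q (X \<omega>) \<partial>M)))"

definition cond_expect_event :: "'a measure \<Rightarrow> ('a \<Rightarrow> real) \<Rightarrow> 'a set \<Rightarrow> real" where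
  "cond_expect_event M f B = (\<integral>\<omega>. f \<omega> \<partial>(uniform_measure M B))"

text \<open>Vectors of dimension \<open>r + 1\<close> are functions on \<open>nat\<close> of which only the coordinates in
  \<open>{0..r}\<close> count.\<close>

definition Cone :: "nat \<Rightarrow> nat \<Rightarrow> (nat \<Rightarrow> nat \<Rightarrow> real) \<Rightarrow> (nat \<Rightarrow> real) set" where
  "Cone r m b =
     {v. \<exists>l. (\<forall>j\<in>{1..m}. l j \<ge> 0) \<and> (\<forall>i\<in>{0..r}. v i = (\<Sum>j=1..m. l j * b j i))}"

end

theory Submission
  imports Defs
begin

text \<open>With \<open>c = (\<Sum>j. l j * b j)\<close> take \<open>a j = l j / (q j - q (j - 1))\<close>. Since \<open>F\<^sub>T(T)\<close> is uniform,
  the step \<open>j\<close> is almost surely the event \<open>q (j - 1) < F\<^sub>T(T) < q j\<close>, so that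
  \<open>E[\<omega>(T) T\<^sup>i] = (\<Sum>j. l j * b j i) = c i\<close>, and \<open>i = 0\<close> shows that \<open>\<omega>\<close> is normalised. The weighted
  variable is again a comonotonic sum: \<open>T\<close> is a sum of monotone functions of one uniform variable
  \<open>U\<close>, weighting \<open>T\<close> weights \<open>U\<close>, and a vector of monotone functions of a single variable is
  comonotonic.\<close>

section \<open>The uniform law on the open unit interval\<close>

abbreviation unif01 :: "real measure" where
  "unif01 \<equiv> uniform_measure lborel {0<..<1}"

abbreviation real_quantile :: "real measure \<Rightarrow> real \<Rightarrow> real" where
  "real_quantile M u \<equiv> real_of_ereal (quantile (cdf M) u)"

lemma prob_space_unif01: "prob_space unif01"
  by (rule prob_space_uniform_measure) auto

lemma AE_unif01: "AE u in unif01. 0 < u \<and> u < 1"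
  by (rule AE_uniform_measureI) auto

lemma AE_unif01I:
  assumes "countable D" and "\<And>u. 0 < u \<Longrightarrow> u < 1 \<Longrightarrow> u \<notin> D \<Longrightarrow> P u"
  shows "AE u in unif01. P u"
proof (rule AE_uniform_measureI)
  have "AE u in lborel. u \<notin> D"
    using countable_imp_null_set_lborel[OF assms(1)] by (rule AE_not_in)
  then show "AE u in lborel. u \<in> {0<..<1} \<longrightarrow> P u"
    by eventually_elim (use assms(2) in auto)
qed simp

text \<open>A bridge to the fact \<open>distr_I_eq_M\<close>, which is phrased with Lebesgue measure
  restricted to the unit interval. The normalising constant of \<open>unif01\<close> is 1, so both
  image laws agree.\<close>

lemma distr_unif01:
  assumes "f \<in> borel_measurable borel"
  shows "distr unif01 borel f = distr (restrict_space lborel {0<..<1}) borel f"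
proof (rule measure_eqI)
  fix A assume "A \<in> sets (distr unif01 borel f)"
  then have A: "A \<in> sets borel" by simp
  have fA: "f -` A \<in> sets borel"
    using measurable_sets[OF assms A] by simp
  have f': "f \<in> borel_measurable (restrict_space lborel {0<..<1})"
    using assms by (intro measurable_restrict_space1) simp
  have "emeasure (distr unif01 borel f) A = emeasure lborel ({0<..<1} \<inter> f -` A)"
    using assms A fA by (subst emeasure_distr) (auto simp: divide_ennreal_def)
  also have "\<dots> = emeasure (distr (restrict_space lborel {0<..<1}) borel f) A"
    using f' A fA
    by (subst emeasure_distr)
      (auto simp: emeasure_restrict_space space_restrict_space Int_commute)
  finally show "emeasure (distr unif01 borel f) A =
      emeasure (distr (restrict_space lborel {0<..<1}) borel f) A" .
qed simp

section \<open>Quantile functions and the probability integral transform\<close>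

context cdf_distribution
begin

text \<open>The Galois connection between quantile and distribution function. The infimum bounds
  \<open>C\<close> from below only strictly to the right of \<open>x\<close>; right continuity
  carries the bound to \<open>x\<close> itself. Because the quantile is extended-real, every real
  \<open>p\<close> is allowed.\<close>

lemma quantile_le_iff: "quantile C p \<le> ereal x \<longleftrightarrow> p \<le> C x"
proof
  assume le: "quantile C p \<le> ereal x"
  have "p \<le> C y" if "x < y" for y
  proof -
    have "quantile C p < ereal y"
      using le that by (meson less_ereal.simps(1) order_le_less_trans)
    then obtain z where "p \<le> C z" "z < y"
      by (auto simp: quantile_def INF_less_iff)
    then show ?thesis
      using cdf_nondecreasing[of z y] by linarith
  qed
  then have "\<forall>\<^sub>F y in at_right x. p \<le> C y"
    by (auto simp: eventually_at_filter)
  moreover have "(C \<longlongrightarrow> C x) (at_right x)"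
    using cont[of x] by (simp add: continuous_within)
  ultimately show "p \<le> C x"
    by (intro tendsto_lowerbound[where F="at_right x"]) auto
next
  assume "p \<le> C x"
  then show "quantile C p \<le> ereal x"
    unfolding quantile_def by (intro INF_lower) simp
qed

text \<open>Inside the unit interval the pseudoinverse \<open>I\<close> obeys the same Galois
  connection, so the two inverses coincide and facts about \<open>I\<close> carry over.\<close>

lemma quantile_eq_I:
  assumes "0 < p" "p < 1"
  shows "quantile C p = ereal (I p)"
proof (rule antisym)
  note I_le = pseudoinverse[OF assms]
  have "p \<le> C (I p)" by (rule I_le[THEN iffD2]) (rule order.refl)
  then show "quantile C p \<le> ereal (I p)"
    by (rule quantile_le_iff[THEN iffD2])
  show "ereal (I p) \<le> quantile C p"
    unfolding quantile_def
  proof (rule INF_greatest)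
    fix x assume "x \<in> {x. p \<le> C x}"
    then have "I p \<le> x" by (intro I_le[THEN iffD1]) (rule CollectD)
    then show "ereal (I p) \<le> ereal x" by (rule ereal_less_eq(3)[THEN iffD2])
  qed
qed

lemma real_quantile_le_iff:
  assumes "0 < p" "p < 1"
  shows "real_quantile M p \<le> x \<longleftrightarrow> p \<le> C x"
  unfolding quantile_eq_I[OF assms] real_of_ereal.simps
  by (rule pseudoinverse[OF assms, symmetric])

lemma mono_real_quantile: "mono_on {0<..<1} (real_quantile M)"
  using mono_I by (simp add: mono_on_def quantile_eq_I)

lemma measurable_real_quantile: "real_quantile M \<in> borel_measurable borel"
proof (rule borel_measurable_piecewise_mono)
  \<comment> \<open>Levels up to 0 and above 1 have infinite quantiles, which
    \<open>real_of_ereal\<close> sends to 0, so the function is constant there. The level 1 may have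
    a finite or an infinite quantile and forms a piece of its own.\<close>
  let ?S = "{{..0}, {0<..<1}, {1}, {1<..}} :: real set set"
  have "quantile C p = -\<infinity>" if "p \<le> 0" for p
    using that cdf_nonneg by (intro ereal_bot) (auto simp: quantile_le_iff intro: order_trans)
  moreover have "quantile C p = \<infinity>" if "1 < p" for p
  proof (rule ereal_top)
    fix x
    have "\<not> quantile C p \<le> ereal x"
      using that cdf_bounded_prob[of x] by (simp add: quantile_le_iff)
    then show "ereal x \<le> quantile C p" by simp
  qed
  ultimately show "mono_on c (real_quantile M)" if "c \<in> ?S" for c
    using that mono_real_quantile by (auto simp: mono_on_def)
  show "\<Union>?S = UNIV" by auto
qed auto

lemma distr_real_quantile: "distr unif01 borel (real_quantile M) = M"
proof -
  have "distr unif01 borel (real_quantile M) =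
      distr (restrict_space lborel {0<..<1}) borel (real_quantile M)"
    by (rule distr_unif01[OF measurable_real_quantile])
  also have "\<dots> = distr (restrict_space lborel {0<..<1}) borel I"
    by (rule distr_cong) (auto simp: space_restrict_space quantile_eq_I)
  finally show ?thesis by (simp add: distr_I_eq_M)
qed

text \<open>Continuity excludes a jump of \<open>C\<close> over the level \<open>u\<close>: strictly
  left of the quantile \<open>C\<close> stays below \<open>u\<close>, and the left limit preserves
  this bound.\<close>

lemma cdf_real_quantile:
  assumes "continuous_on UNIV C" "0 < u" "u < 1"
  shows "C (real_quantile M u) = u"
proof (rule antisym)
  let ?x = "real_quantile M u"
  show "u \<le> C ?x"
    using assms(2,3) real_quantile_le_iff by blast
  have "(C \<longlongrightarrow> C ?x) (at_left ?x)"
    using assms(1) by (auto simp: continuous_on_def intro: tendsto_within_subset)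
  moreover have "C y \<le> u" if "y < ?x" for y
    using that assms(2,3) real_quantile_le_iff[of u y] by linarith
  then have "\<forall>\<^sub>F y in at_left ?x. C y \<le> u"
    by (auto simp: eventually_at_filter)
  ultimately show "C ?x \<le> u"
    by (intro tendsto_upperbound[where F="at_left ?x"]) auto
qed

text \<open>Write \<open>M\<close> as the law of its quantile function at a uniform variable;
  applying \<open>C\<close> then returns that variable.\<close>

lemma distr_cdf:
  assumes "continuous_on UNIV C"
  shows "distr M borel C = unif01"
proof -
  note measurable_real_quantile [measurable]
  have "distr M borel C = distr (distr unif01 borel (real_quantile M)) borel C"
    by (simp only: distr_real_quantile)
  also have "\<dots> = distr unif01 borel (\<lambda>u. C (real_quantile M u))"
    by (subst distr_distr) (auto simp: comp_def)
  also have "\<dots> = distr unif01 borel (\<lambda>u. u)"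
    using assms
    by (intro distr_cong_AE) (auto intro!: AE_unif01I[of "{}"] cdf_real_quantile)
  also have "\<dots> = unif01"
    by (rule distr_id2) simp
  finally show ?thesis .
qed

lemma AE_cdf_neq:
  assumes "continuous_on UNIV C"
  shows "AE x in M. C x \<noteq> p"
proof -
  have "AE u in distr M borel C. u \<noteq> p"
    unfolding distr_cdf[OF assms] by (rule AE_unif01I[of "{p}"]) auto
  then show ?thesis
    by (rule AE_distrD[rotated]) simp
qed

lemma measure_cdf_between:
  assumes "continuous_on UNIV C" "0 \<le> p" "p \<le> p'" "p' \<le> 1"
  shows "measure M {x. p < C x \<and> C x < p'} = p' - p"
proof -
  have "{0<..<1} \<inter> {p<..<p'} = {p<..<p'}" using assms by auto
  then have "measure unif01 {p<..<p'} = p' - p" using assms by simp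
  then have "measure (distr M borel C) {p<..<p'} = p' - p"
    unfolding distr_cdf[OF assms(1)] .
  then show ?thesis
    by (subst (asm) measure_distr) (auto simp: vimage_def)
qed

text \<open>The level \<open>p\<close> itself has to be avoided: at the left end of a flat stretch
  of \<open>C\<close> at height \<open>p\<close>, the point equals the quantile although
  \<open>C x < p\<close> fails. Otherwise left continuity provides a point below \<open>x\<close>
  whose value still exceeds \<open>p\<close>.\<close>

lemma le_quantile_iff:
  assumes "continuous_on UNIV C" "C x \<noteq> p"
  shows "ereal x \<le> quantile C p \<longleftrightarrow> C x < p"
proof
  assume "C x < p"
  then have "\<not> quantile C p \<le> ereal x" by (simp add: quantile_le_iff)
  then show "ereal x \<le> quantile C p" by simp
next
  assume le: "ereal x \<le> quantile C p"
  show "C x < p"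
  proof (rule ccontr)
    assume "\<not> C x < p"
    then have "p < C x" using assms(2) by simp
    moreover have "(C \<longlongrightarrow> C x) (at_left x)"
      using assms(1) by (auto simp: continuous_on_def intro: tendsto_within_subset)
    ultimately have "\<forall>\<^sub>F y in at_left x. p < C y"
      by (intro order_tendstoD)
    moreover have "\<forall>\<^sub>F y in at_left x. y < x"
      by (simp add: eventually_at_filter)
    ultimately have "\<forall>\<^sub>F y in at_left x. p < C y \<and> y < x"
      by (rule eventually_conj)
    then obtain y where "p < C y" "y < x"
      using eventually_happens trivial_limit_at_left_real by blast
    then have "quantile C p \<le> ereal y" by (simp add: quantile_le_iff)
    with le \<open>y < x\<close> show False
      using dual_order.trans by fastforce
  qed
qed

text \<open>Serves the first step, whose left endpoint is the upper quantile at 0 instead of the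
  ordinary quantile, which is minus infinity there.\<close>

lemma upper_quantile_0_le:
  assumes "0 < C x"
  shows "upper_quantile C 0 \<le> ereal x"
  unfolding upper_quantile_def
proof (rule SUP_least)
  fix y assume "y \<in> {x. C x \<le> 0}"
  then show "ereal y \<le> ereal x"
    using assms cdf_nondecreasing[of x y] by (cases "x \<le> y") auto
qed

end

section \<open>Monotone functions of a uniform variable and comonotonic sums\<close>

text \<open>At a continuity point \<open>u\<close> the only candidate for the quantile is \<open>f u\<close>, and a monotone
  function has countably many discontinuities.\<close>

lemma real_quantile_distr_unif01:
  assumes f_mono: "mono_on {0<..<1} f" and [measurable]: "f \<in> borel_measurable borel"
  shows "AE u in unif01. real_quantile (distr unif01 borel f) u = f u"
proof (rule AE_unif01I)
  interpret U: prob_space unif01 by (rule prob_space_unif01)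
  let ?D = "distr unif01 borel f"
  have m: "f \<in> borel_measurable unif01" by simp
  interpret cdf_distribution ?D
    using U.real_distribution_distr[OF m] by (simp add: cdf_distribution_def)
  have C_eq: "C x = measure unif01 {v. f v \<le> x}" for x
    by (simp add: cdf_def2 measure_distr vimage_def)
  show "countable {a\<in>{0<..<1}. \<not> isCont f a}"
    using mono_on_ctble_discont_open[of "{0<..<1}" f] f_mono by simp
  fix u :: real assume u: "0 < u" "u < 1" "u \<notin> {a\<in>{0<..<1}. \<not> isCont f a}"
  have "quantile C u = ereal (f u)"
  proof (rule antisym)
    \<comment> \<open>By monotonicity \<open>f\<close> is at most \<open>f u\<close> on the interval
      below \<open>u\<close>, whose mass is \<open>u\<close>.\<close>
    have "u = measure unif01 {0<..<u}" using u by simp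
    also have "\<dots> \<le> measure unif01 ({v. f v \<le> f u} \<inter> {0<..<1})"
      using u f_mono by (intro U.finite_measure_mono) (auto simp: mono_on_def)
    also have "\<dots> \<le> measure unif01 {v. f v \<le> f u}"
      by (intro U.finite_measure_mono) auto
    finally show "quantile C u \<le> ereal (f u)"
      by (simp add: quantile_le_iff C_eq)
    show "ereal (f u) \<le> quantile C u"
    proof (rule ccontr)
      \<comment> \<open>Left continuity at \<open>u\<close> yields some \<open>v < u\<close> with
        \<open>f v\<close> still above \<open>x\<close>. Monotonicity then confines the event
        \<open>f \<le> x\<close> to the interval below \<open>v\<close>, so
        \<open>C x \<le> v < u\<close>, against the Galois connection.\<close>
      assume "\<not> ereal (f u) \<le> quantile C u"
      then obtain x where x: "quantile C u < ereal x" "x < f u"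
        using ereal_dense2[of "quantile C u" "ereal (f u)"] by (auto simp: not_le)
      have "(f \<longlongrightarrow> f u) (at_left u)"
        using u by (auto simp: isCont_def intro: tendsto_within_subset)
      then have "\<forall>\<^sub>F v in at_left u. x < f v"
        using x(2) by (intro order_tendstoD)
      moreover have "\<forall>\<^sub>F v in at_left u. v \<in> {0<..<u}"
        using u(1) by (rule eventually_at_left_real)
      ultimately have "\<forall>\<^sub>F v in at_left u. x < f v \<and> v \<in> {0<..<u}"
        by (rule eventually_conj)
      then obtain v where v: "x < f v" "0 < v" "v < u"
        using eventually_happens trivial_limit_at_left_real greaterThanLessThan_iff by blast
      have "C x = measure unif01 ({v. f v \<le> x} \<inter> {0<..<1})"
        unfolding C_eq using AE_unif01 by (intro measure_eq_AE) auto
      also have "\<dots> \<le> measure unif01 {0<..<v}"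
      proof (rule U.finite_measure_mono)
        show "{v. f v \<le> x} \<inter> {0<..<1} \<subseteq> {0<..<v}"
        proof
          fix y assume y: "y \<in> {v. f v \<le> x} \<inter> {0<..<1}"
          then have "\<not> v \<le> y"
            using f_mono v u by (auto simp: mono_on_def) (smt (verit))
          with y show "y \<in> {0<..<v}" by auto
        qed
      qed simp
      also have "\<dots> = v" using u v by simp
      finally have "C x < u" using v by simp
      with x(1) show False using quantile_le_iff[of u x] by simp
    qed
  qed
  then show "real_quantile ?D u = f u" by simp
qed

text \<open>Each \<open>f i\<close> is almost everywhere its own marginal quantile function;
  finitely many null sets are discarded, and the two vectors agree almost everywhere.\<close>

lemma comonotonic_unif01:
  assumes "\<And>i. i \<in> {1..n} \<Longrightarrow> mono_on {0<..<1} (f i)"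
    and meas: "\<And>i. i \<in> {1..n} \<Longrightarrow> f i \<in> borel_measurable borel"
  shows "comonotonic n unif01 f"
  unfolding comonotonic_def
proof (intro conjI ballI distr_cong_AE)
  interpret U: prob_space unif01 by (rule prob_space_unif01)
  show "f i \<in> borel_measurable unif01" if "i \<in> {1..n}" for i
    using meas[OF that] by simp
  note m = this
  have mq: "real_quantile (distr unif01 borel (f i)) \<in> borel_measurable unif01"
    if "i \<in> {1..n}" for i
    using cdf_distribution.measurable_real_quantile[of "distr unif01 borel (f i)"]
      U.real_distribution_distr[OF m[OF that]] by (simp add: cdf_distribution_def)
  show "(\<lambda>u. \<lambda>i\<in>{1..n}. f i u) \<in> measurable unif01 (\<Pi>\<^sub>M i\<in>{1..n}. borel)"
    by (rule measurable_restrict) (rule m)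
  show "(\<lambda>u. \<lambda>i\<in>{1..n}. real_quantile (distr unif01 borel (f i)) u)
      \<in> measurable unif01 (\<Pi>\<^sub>M i\<in>{1..n}. borel)"
    by (rule measurable_restrict) (rule mq)
  have "AE u in unif01. \<forall>i\<in>{1..n}. real_quantile (distr unif01 borel (f i)) u = f i u"
    by (intro AE_finite_allI real_quantile_distr_unif01 assms) auto
  then show "AE u in unif01. (\<lambda>i\<in>{1..n}. f i u) =
      (\<lambda>i\<in>{1..n}. real_quantile (distr unif01 borel (f i)) u)"
    by eventually_elim auto
qed auto

text \<open>Summing coordinates is measurable on the product space, so the equality of vector laws
  that defines comonotonicity can be pushed forward along it.\<close>

lemma comonotonic_sum_distr:
  assumes N: "prob_space N" and "comonotonic n N Z"
  shows "distr N borel (\<lambda>x. \<Sum>i=1..n. Z i x) =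
    distr unif01 borel (\<lambda>u. \<Sum>i=1..n. real_quantile (distr N borel (Z i)) u)"
proof -
  interpret prob_space N by (rule N)
  let ?P = "\<Pi>\<^sub>M i\<in>{1..n}. (borel :: real measure)"
  let ?q = "\<lambda>i. real_quantile (distr N borel (Z i))"
  have m: "Z i \<in> borel_measurable N" if "i \<in> {1..n}" for i
    using assms(2) that by (auto simp: comonotonic_def)
  have mq: "?q i \<in> borel_measurable unif01" if "i \<in> {1..n}" for i
    using cdf_distribution.measurable_real_quantile[of "distr N borel (Z i)"]
      real_distribution_distr[OF m[OF that]] by (simp add: cdf_distribution_def)
  have s: "(\<lambda>v. \<Sum>i=1..n. v i) \<in> borel_measurable ?P"
    by (intro borel_measurable_sum measurable_component_singleton) auto
  have "distr N borel (\<lambda>x. \<Sum>i=1..n. Z i x) =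
      distr (distr N ?P (\<lambda>x. \<lambda>i\<in>{1..n}. Z i x)) borel (\<lambda>v. \<Sum>i=1..n. v i)"
    by (subst distr_distr[OF s measurable_restrict[OF m]]) (auto simp: comp_def)
  also have "\<dots> = distr (distr unif01 ?P (\<lambda>u. \<lambda>i\<in>{1..n}. ?q i u)) borel (\<lambda>v. \<Sum>i=1..n. v i)"
    using assms(2) by (simp add: comonotonic_def)
  also have "\<dots> = distr unif01 borel (\<lambda>u. \<Sum>i=1..n. ?q i u)"
    by (subst distr_distr[OF s measurable_restrict[OF mq]]) (auto simp: comp_def)
  finally show ?thesis .
qed

text \<open>If \<open>h\<close> is the vector of marginal quantile functions, then reweighting the law of the sum
  amounts to reweighting the uniform law itself, and the reweighted uniform law is that of
  \<open>g(U)\<close> for its own quantile function \<open>g\<close>; the maps \<open>h i \<circ> g\<close> are again monotone.\<close>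

lemma comonotonic_sum_density:
  fixes w :: "real \<Rightarrow> ennreal"
  assumes N: "prob_space N" and com: "comonotonic n N Z"
    and w [measurable]: "w \<in> borel_measurable borel"
    and prob: "prob_space (density (distr N borel (\<lambda>x. \<Sum>i=1..n. Z i x)) w)"
  obtains f where "comonotonic n unif01 f"
    and "distr unif01 borel (\<lambda>u. \<Sum>i=1..n. f i u) =
      density (distr N borel (\<lambda>x. \<Sum>i=1..n. Z i x)) w"
proof -
  interpret N: prob_space N by (rule N)
  define h where "h i = real_quantile (distr N borel (Z i))" for i
  define s where "s u = (\<Sum>i=1..n. h i u)" for u
  have dist: "cdf_distribution (distr N borel (Z i))" if "i \<in> {1..n}" for i
    using com that by (simp add: cdf_distribution_def comonotonic_def N.real_distribution_distr)
  have h_mono: "mono_on {0<..<1} (h i)" if "i \<in> {1..n}" for i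
    unfolding h_def using cdf_distribution.mono_real_quantile[OF dist[OF that]] .
  have h_meas: "h i \<in> borel_measurable borel" if "i \<in> {1..n}" for i
    unfolding h_def using cdf_distribution.measurable_real_quantile[OF dist[OF that]] .
  have s_meas [measurable]: "s \<in> borel_measurable borel"
    unfolding s_def using h_meas by (intro borel_measurable_sum) auto
  define \<nu> where "\<nu> = density unif01 (\<lambda>u. w (s u))"
  \<comment> \<open>A density on an image law is the image of the density composed with the map, so
    \<open>w\<close> on the sum becomes \<open>w (s u)\<close> on the uniform variable.\<close>
  have law: "density (distr N borel (\<lambda>x. \<Sum>i=1..n. Z i x)) w = distr \<nu> borel s"
    unfolding comonotonic_sum_distr[OF N com] \<nu>_def
    using s_meas by (subst density_distr) (simp_all add: s_def[abs_def] h_def)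
  have sets_\<nu> [simp]: "sets \<nu> = sets borel" by (simp add: \<nu>_def)
  then have space_\<nu> [simp]: "space \<nu> = UNIV" by (simp add: \<nu>_def)
  have meas_\<nu>: "measurable \<nu> borel = measurable borel (borel :: real measure)"
    by (rule measurable_cong_sets) auto
  have "prob_space \<nu>"
  proof
    have "emeasure (distr \<nu> borel s) UNIV = 1"
      using prob_space.emeasure_space_1[OF prob] unfolding law by simp
    then show "emeasure \<nu> (space \<nu>) = 1"
      by (subst (asm) emeasure_distr) (auto simp: meas_\<nu>)
  qed
  then interpret \<nu>: cdf_distribution \<nu>
    by (simp add: cdf_distribution_def real_distribution_def real_distribution_axioms_def)
  have AE_\<nu>: "AE u in \<nu>. P u" if "AE u in unif01. P u" for P
    unfolding \<nu>_def using that by (subst AE_density) auto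
  \<comment> \<open>As a density over \<open>unif01\<close>, \<nu> lives on the open unit interval.
    This and the limit at 1 keep \<open>g\<close> strictly between 0 and 1, the only range where the
    \<open>h i\<close> are known to be monotone.\<close>
  have C0: "\<nu>.C 0 = 0"
  proof -
    have "\<nu>.C 0 = measure \<nu> {}"
      unfolding cdf_def2 using AE_\<nu>[OF AE_unif01] by (intro measure_eq_AE) auto
    then show ?thesis by simp
  qed
  have C1: "(\<nu>.C \<longlongrightarrow> 1) (at_left 1)"
  proof -
    have "measure \<nu> {..<1} = measure \<nu> UNIV"
      using AE_\<nu>[OF AE_unif01] by (intro measure_eq_AE) auto
    then show ?thesis
      using \<nu>.cdf_at_left[of 1] \<nu>.prob_space by simp
  qed
  define g where "g = real_quantile \<nu>"
  have g_meas [measurable]: "g \<in> borel_measurable borel"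
    unfolding g_def by (rule \<nu>.measurable_real_quantile)
  have g01: "0 < g u \<and> g u < 1" if u: "0 < u" "u < 1" for u
  proof -
    have le: "g u \<le> x \<longleftrightarrow> u \<le> \<nu>.C x" for x
      unfolding g_def using u by (rule \<nu>.real_quantile_le_iff)
    have "\<forall>\<^sub>F x in at_left 1. u < \<nu>.C x \<and> x < 1"
      using order_tendstoD(1)[OF C1 u(2)]
      by (auto simp: eventually_conj_iff eventually_at_filter)
    then obtain x where "u < \<nu>.C x" "x < 1"
      using eventually_happens trivial_limit_at_left_real by blast
    then show ?thesis
      using le[of x] le[of 0] C0 u by auto
  qed
  have g_mono: "mono_on {0<..<1} g"
    unfolding g_def by (rule \<nu>.mono_real_quantile)
  define f where "f i u = h i (g u)" for i u
  have "comonotonic n unif01 f"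
  proof (rule comonotonic_unif01)
    fix i assume i: "i \<in> {1..n}"
    show "mono_on {0<..<1} (f i)"
      using h_mono[OF i] g_mono g01 by (auto simp: f_def mono_on_def)
    show "f i \<in> borel_measurable borel"
      unfolding f_def[abs_def] by (rule measurable_compose[OF g_meas h_meas[OF i]])
  qed
  moreover have "distr unif01 borel (\<lambda>u. \<Sum>i=1..n. f i u) = distr \<nu> borel s"
  proof -
    have "distr unif01 borel (\<lambda>u. \<Sum>i=1..n. f i u) = distr (distr unif01 borel g) borel s"
      by (subst distr_distr) (auto simp: comp_def f_def s_def)
    then show ?thesis
      by (simp add: g_def \<nu>.distr_real_quantile)
  qed
  ultimately show thesis
    using that law by simp
qed

text \<open>A comonotonic vector is a comonotonic modification of itself, so \<open>f\<close> on
  \<open>unif01\<close> serves both as \<open>Z\<close> and as \<open>Zc\<close>.\<close>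

lemma comonotonic_approximation_density:
  fixes w :: "real \<Rightarrow> ennreal"
  assumes "prob_space N" "comonotonic n N Z" "w \<in> borel_measurable borel"
    and D: "D = density (distr N borel (\<lambda>x. \<Sum>i=1..n. Z i x)) w" and "prob_space D"
  shows "comonotonic_approximation n D (\<lambda>x. x)"
proof -
  obtain f where f: "comonotonic n unif01 f"
    "distr unif01 borel (\<lambda>u. \<Sum>i=1..n. f i u) = D"
    using comonotonic_sum_density[OF assms(1,2,3)] assms(4,5) by metis
  have "comonotonic_modification n unif01 f unif01 f"
    using f(1) prob_space_unif01 by (auto simp: comonotonic_modification_def comonotonic_def)
  moreover have "distr D borel (\<lambda>x. x) = D"
    by (rule distr_id2) (simp add: D)
  moreover have "(\<lambda>x. x) \<in> borel_measurable D"
    by (simp add: D)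
  ultimately show ?thesis
    using f(2) unfolding comonotonic_approximation_def by metis
qed

section \<open>Conditional moments and step weights\<close>

lemma cond_expect_event_eq:
  fixes f :: "'a \<Rightarrow> real"
  assumes "prob_space M" "f \<in> borel_measurable M" and B: "B \<in> sets M" "measure M B > 0"
  shows "cond_expect_event M f B = (\<integral>x. f x * indicator B x \<partial>M) / measure M B"
proof -
  interpret prob_space M by fact
  have "uniform_measure M B = density M (\<lambda>x. ennreal (indicator B x / measure M B))"
    unfolding uniform_measure_def
    using B(2) by (intro arg_cong[where f="density M"] ext)
      (simp add: emeasure_eq_measure divide_ennreal flip: ennreal_indicator)
  then have "cond_expect_event M f B = (\<integral>x. f x * indicator B x / measure M B \<partial>M)"
    unfolding cond_expect_event_def using assms B
    by (simp add: integral_density mult.commute)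
  then show ?thesis by simp
qed

text \<open>Powers up to \<open>r\<close> are dominated by \<open>1 + \<bar>f x\<bar> ^ r\<close>,
  by separating values of modulus at most 1 from larger ones.\<close>

lemma integrable_power_le:
  fixes f :: "'a \<Rightarrow> real"
  assumes "prob_space M" "f \<in> borel_measurable M" "integrable M (\<lambda>x. \<bar>f x\<bar> ^ r)" "i \<le> r"
  shows "integrable M (\<lambda>x. f x ^ i)"
proof (rule Bochner_Integration.integrable_bound)
  interpret prob_space M by fact
  show "integrable M (\<lambda>x. 1 + \<bar>f x\<bar> ^ r)" using assms(3) by simp
  have "\<bar>f x\<bar> ^ i \<le> 1 + \<bar>f x\<bar> ^ r" for x
  proof (cases "\<bar>f x\<bar> \<le> 1")
    case True
    then have "\<bar>f x\<bar> ^ i \<le> 1" by (intro power_le_one) auto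
    then show ?thesis by (simp add: add_increasing2)
  next
    case False
    then have "\<bar>f x\<bar> ^ i \<le> \<bar>f x\<bar> ^ r" using assms(4) by (intro power_increasing) auto
    then show ?thesis by simp
  qed
  then show "AE x in M. norm (f x ^ i) \<le> norm (1 + \<bar>f x\<bar> ^ r)"
    by (simp add: power_abs)
  show "(\<lambda>x. f x ^ i) \<in> borel_measurable M" using assms(2) by simp
qed

text \<open>A common stand-in for the half-open steps of the weight and the closed conditioning
  events in \<open>b\<close>. For a continuous distribution function these differ from it only where
  \<open>F\<close> hits one of the levels, a null event; hence the strict inequalities on both
  sides.\<close>

definition level_band :: "(real \<Rightarrow> real) \<Rightarrow> (nat \<Rightarrow> real) \<Rightarrow> nat \<Rightarrow> real set" where
  "level_band F q k = {x. q (k - 1) < F x \<and> F x < q k}"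

lemma measurable_step [measurable]: "step F m q k \<in> sets borel"
  unfolding step_def by measurable

context cdf_distribution
begin

lemma measurable_level_band [measurable]: "level_band C q k \<in> sets borel"
  unfolding level_band_def by measurable

lemma AE_step:
  assumes C: "continuous_on UNIV C" and "q 0 = 0"
  shows "AE x in M. \<forall>k\<in>{1..m}. x \<in> step C m q k \<longleftrightarrow> x \<in> level_band C q k"
proof -
  have "AE x in M. \<forall>k\<in>{0..m}. C x \<noteq> q k"
    by (intro AE_finite_allI AE_cdf_neq[OF C]) simp
  then show ?thesis
  proof eventually_elim
    case (elim x)
    show ?case
    proof
      fix k assume k: "k \<in> {1..m}"
      have ne: "C x \<noteq> q (k - 1)" "C x \<noteq> q k" "C x \<noteq> q 0"
        using elim k by auto
      \<comment> \<open>For \<open>k = 1\<close> both sides are true: \<open>C x\<close> is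
        nonnegative and differs from \<open>q 0 = 0\<close>.\<close>
      have "(if k = 1 then upper_quantile C (q 0) else quantile C (q (k - 1))) \<le> ereal x
          \<longleftrightarrow> q (k - 1) < C x"
        using ne cdf_nonneg[of x] upper_quantile_0_le[of x] assms(2)
        by (auto simp: quantile_le_iff)
      moreover have "(if k = m then ereal x \<le> quantile C (q m) else ereal x < quantile C (q k))
          \<longleftrightarrow> C x < q k"
        using ne quantile_le_iff[of "q k" x] le_quantile_iff[OF C, of x "q k"] by (auto simp: not_le)
      ultimately show "x \<in> step C m q k \<longleftrightarrow> x \<in> level_band C q k"
        by (simp add: step_def level_band_def)
    qed
  qed
qed

lemma AE_quantile_band:
  assumes C: "continuous_on UNIV C"
  shows "AE x in M. quantile C (q (k - 1)) \<le> ereal x \<and> ereal x \<le> quantile C (q k)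
    \<longleftrightarrow> x \<in> level_band C q k"
  using AE_cdf_neq[OF C, of "q (k - 1)"] AE_cdf_neq[OF C, of "q k"]
  by eventually_elim (use C in \<open>auto simp: quantile_le_iff le_quantile_iff level_band_def\<close>)

end

text \<open>The conditioning event has probability \<open>q k - q (k - 1)\<close> because the
  distribution function makes \<open>X\<close> uniform. The product form is chosen so that this
  factor cancels the denominator in the weights.\<close>

lemma cond_expect_event_quantile_band:
  fixes q :: "nat \<Rightarrow> real"
  assumes M: "prob_space M" and X: "continuous_rv M X"
    and q: "0 \<le> q (k - 1)" "q (k - 1) < q k" "q k \<le> 1"
  defines "F \<equiv> cdf (distr M borel X)"
  shows "cond_expect_event M (\<lambda>\<omega>. X \<omega> ^ i)
      {\<omega> \<in> space M. quantile F (q (k - 1)) \<le> ereal (X \<omega>) \<and> ereal (X \<omega>) \<le> quantile F (q k)} *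
      (q k - q (k - 1)) =
    (\<integral>x. x ^ i * indicator (level_band F q k) x \<partial>distr M borel X)"
proof -
  interpret prob_space M by fact
  have [measurable]: "X \<in> borel_measurable M" and C: "continuous_on UNIV (cdf (distr M borel X))"
    using X by (auto simp: continuous_rv_def)
  interpret D: cdf_distribution "distr M borel X"
    by (simp add: cdf_distribution_def real_distribution_distr)
  let ?E = "{\<omega> \<in> space M. quantile F (q (k - 1)) \<le> ereal (X \<omega>) \<and> ereal (X \<omega>) \<le> quantile F (q k)}"
  let ?B = "{\<omega> \<in> space M. X \<omega> \<in> level_band F q k}"
  have [measurable]: "level_band F q k \<in> sets borel"
    unfolding F_def by (rule D.measurable_level_band)
  have AE: "AE \<omega> in M. \<omega> \<in> ?E \<longleftrightarrow> \<omega> \<in> ?B"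
    using AE_distrD[OF _ D.AE_quantile_band[OF C, of q k]] AE_space
    by (auto simp: F_def elim: eventually_elim2)
  have "measure M ?E = measure M ?B"
    using AE by (intro measure_eq_AE) measurable
  also have "\<dots> = measure (distr M borel X) (level_band F q k)"
    by (subst measure_distr) (auto intro!: arg_cong[where f="measure M"])
  also have "\<dots> = q k - q (k - 1)"
    unfolding F_def level_band_def using q by (intro D.measure_cdf_between[OF C]) auto
  finally have ME: "measure M ?E = q k - q (k - 1)" .
  have "cond_expect_event M (\<lambda>\<omega>. X \<omega> ^ i) ?E =
      (\<integral>\<omega>. X \<omega> ^ i * indicator ?E \<omega> \<partial>M) / measure M ?E"
    using q ME by (intro cond_expect_event_eq[OF M]) measurable
  also have "(\<integral>\<omega>. X \<omega> ^ i * indicator ?E \<omega> \<partial>M) =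
      (\<integral>\<omega>. X \<omega> ^ i * indicator (level_band F q k) (X \<omega>) \<partial>M)"
  proof (rule integral_cong_AE)
    show "AE \<omega> in M. X \<omega> ^ i * indicator ?E \<omega> = X \<omega> ^ i * indicator (level_band F q k) (X \<omega>)"
      using AE AE_space by eventually_elim (simp add: indicator_def)
  qed measurable
  also have "\<dots> = (\<integral>x. x ^ i * indicator (level_band F q k) x \<partial>distr M borel X)"
    by (rule integral_distr[symmetric]) measurable
  finally show ?thesis
    using q ME by simp
qed

text \<open>The weight is a finite combination of step indicators; linearity splits the integral,
  and each step may be replaced by its band up to a null set.\<close>

lemma step_weight_integral:
  fixes q :: "nat \<Rightarrow> real"
  assumes M: "prob_space M" and X: "continuous_rv M X" and q0: "q 0 = 0"
    and int: "integrable M (\<lambda>\<omega>. X \<omega> ^ i)"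
  defines "\<mu> \<equiv> distr M borel X"
  shows "integrable \<mu> (\<lambda>x. step_weight M X m a q x * x ^ i)" (is ?int)
    and "(\<integral>x. step_weight M X m a q x * x ^ i \<partial>\<mu>) =
      (\<Sum>k=1..m. a k * (\<integral>x. x ^ i * indicator (level_band (cdf \<mu>) q k) x \<partial>\<mu>))" (is ?eq)
proof -
  interpret prob_space M by fact
  have [measurable]: "X \<in> borel_measurable M" and C: "continuous_on UNIV (cdf \<mu>)"
    using X by (auto simp: continuous_rv_def \<mu>_def)
  interpret D: cdf_distribution \<mu>
    unfolding \<mu>_def by (simp add: cdf_distribution_def real_distribution_distr)
  have "integrable \<mu> (\<lambda>x. x ^ i)"
    unfolding \<mu>_def using int by (subst integrable_distr_eq) auto
  then have I: "integrable \<mu> (\<lambda>x. x ^ i * indicator A x)" if "A \<in> sets borel" for A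
    using that by (intro integrable_real_mult_indicator) (auto simp: \<mu>_def)
  have eq: "step_weight M X m a q x * x ^ i =
      (\<Sum>k=1..m. a k * (x ^ i * indicator (step (cdf \<mu>) m q k) x))" for x
    unfolding step_weight_def \<mu>_def sum_distrib_right by (intro sum.cong refl) (simp only: mult_ac)
  show ?int
    unfolding eq by (intro Bochner_Integration.integrable_sum integrable_mult_right I) simp
  have "(\<integral>x. step_weight M X m a q x * x ^ i \<partial>\<mu>) =
      (\<Sum>k=1..m. a k * (\<integral>x. x ^ i * indicator (step (cdf \<mu>) m q k) x \<partial>\<mu>))"
    unfolding eq by (subst Bochner_Integration.integral_sum)
      (auto intro!: I integrable_mult_right)
  also have "\<dots> = (\<Sum>k=1..m. a k * (\<integral>x. x ^ i * indicator (level_band (cdf \<mu>) q k) x \<partial>\<mu>))"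
  proof (intro sum.cong refl arg_cong2[where f="(*)"] integral_cong_AE)
    fix k assume k: "k \<in> {1..m}"
    show "AE x in \<mu>. x ^ i * indicator (step (cdf \<mu>) m q k) x =
        x ^ i * indicator (level_band (cdf \<mu>) q k) x"
      using D.AE_step[where m=m and q=q, OF C q0] by eventually_elim (use k in \<open>simp add: indicator_def\<close>)
  qed measurable
  finally show ?eq .
qed

section \<open>Matching the moments of the sum by a step-weighted version\<close>

theorem theorem6p1:
  fixes M :: "'a measure" and X :: "nat \<Rightarrow> 'a \<Rightarrow> real" and S :: "'a \<Rightarrow> real"
    and MT :: "'b measure" and T :: "'b \<Rightarrow> real"
    and MY :: "'c measure" and Y :: "nat \<Rightarrow> 'c \<Rightarrow> real"
    and MYc :: "'d measure" and Yc :: "nat \<Rightarrow> 'd \<Rightarrow> real"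
    and n r m :: nat and q :: "nat \<Rightarrow> real"
    and c :: "nat \<Rightarrow> real" and b :: "nat \<Rightarrow> nat \<Rightarrow> real"
  assumes "prob_space M"
    and "\<forall>i\<in>{1..n}. continuous_rv M (X i)"
    and "S = (\<lambda>\<omega>. \<Sum>i=1..n. X i \<omega>)"
    and "prob_space MT"
    and "continuous_rv MT T"
    and "\<forall>i\<in>{1..n}. continuous_rv MY (Y i)"
    and "comonotonic_modification n MY Y MYc Yc"
    and "distr MT borel T = distr MYc borel (\<lambda>\<omega>. \<Sum>i=1..n. Yc i \<omega>)"
    and "r \<ge> 1"
    and "integrable M (\<lambda>\<omega>. \<bar>S \<omega>\<bar> ^ r)"
    and "integrable MT (\<lambda>\<omega>. \<bar>T \<omega>\<bar> ^ r)"
    and "c = (\<lambda>i. if i = 0 then 1 else (\<integral>\<omega>. S \<omega> ^ i \<partial>M))"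
    and "q 0 = 0" and "q m = 1" and "\<forall>j<m. q j < q (Suc j)"
    and "b = (\<lambda>j i. if i = 0 then 1 else
           cond_expect_event MT (\<lambda>\<omega>. T \<omega> ^ i)
             {\<omega> \<in> space MT.
                quantile (cdf (distr MT borel T)) (q (j - 1)) \<le> ereal (T \<omega>) \<and>
                ereal (T \<omega>) \<le> quantile (cdf (distr MT borel T)) (q j)})"
    and "c \<in> Cone r m b"
  shows "\<exists>(a :: nat \<Rightarrow> real) (N :: real measure) (W :: real \<Rightarrow> real).
           Min (a ` {1..m}) \<ge> 0 \<and> Max (a ` {1..m}) > 0 \<and>
           prob_space N \<and>
           step_weighted_version MT T m a q N W \<and>
           comonotonic_approximation n N W \<and>
           (\<forall>i\<in>{1..r}. integrable N (\<lambda>x. W x ^ i) \<and>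
                         (\<integral>x. W x ^ i \<partial>N) = (\<integral>\<omega>. S \<omega> ^ i \<partial>M))"
proof -
  interpret MT: prob_space MT by fact
  define \<mu> where "\<mu> = distr MT borel T"
  have T [measurable]: "T \<in> borel_measurable MT" and C: "continuous_on UNIV (cdf \<mu>)"
    using assms(5) by (auto simp: continuous_rv_def \<mu>_def)
  interpret \<mu>: cdf_distribution \<mu>
    unfolding \<mu>_def by (simp add: cdf_distribution_def MT.real_distribution_distr)
  have q_mono: "q j \<le> q k" if "j \<le> k" "k \<le> m" for j k
    using that
  proof (induction k rule: dec_induct)
    case (step k)
    then show ?case using assms(15) by (meson Suc_le_lessD less_imp_le order_trans)
  qed simp
  have q: "0 \<le> q (k - 1)" "q (k - 1) < q k" "q k \<le> 1" if "k \<in> {1..m}" for k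
  proof -
    show "0 \<le> q (k - 1)" using q_mono[of 0 "k - 1"] that assms(13) by auto
    show "q k \<le> 1" using q_mono[of k m] that assms(14) by auto
    show "q (k - 1) < q k" using assms(15)[rule_format, of "k - 1"] that by auto
  qed
  \<comment> \<open>Ensures that the minimum is taken over a nonempty set.\<close>
  have "m \<ge> 1" using assms(13,14) by (cases m) auto
  obtain l where l_nonneg: "\<And>j. j \<in> {1..m} \<Longrightarrow> l j \<ge> 0"
    and l: "\<And>i. i \<le> r \<Longrightarrow> c i = (\<Sum>j=1..m. l j * b j i)"
    using assms(17) unfolding Cone_def by fastforce
  \<comment> \<open>Coordinate 0 of the cone identity, where \<open>c\<close> and every
    \<open>b j\<close> equal 1. It also forces some \<open>l j\<close> to be positive, hence the
    positive maximum of \<open>a\<close>.\<close>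
  have l_sum: "(\<Sum>j=1..m. l j) = 1"
    using l[of 0] by (simp add: assms(12,16))
  define a where "a j = l j / (q j - q (j - 1))" for j
  have a_nonneg: "a j \<ge> 0" if "j \<in> {1..m}" for j
    using l_nonneg[OF that] q[OF that] by (simp add: a_def)
  have "\<exists>j\<in>{1..m}. l j > 0"
  proof (rule ccontr)
    assume "\<not> (\<exists>j\<in>{1..m}. l j > 0)"
    then have "(\<Sum>j=1..m. l j) \<le> 0" by (intro sum_nonpos) (auto simp: not_less)
    then show False using l_sum by simp
  qed
  then have "\<exists>j\<in>{1..m}. a j > 0"
    using q(2) by (auto simp: a_def intro!: bexI divide_pos_pos)
  then have a_Max: "Max (a ` {1..m}) > 0"
    by (subst Max_gr_iff) auto
  have a_Min: "Min (a ` {1..m}) \<ge> 0"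
    using a_nonneg \<open>m \<ge> 1\<close> by (subst Min_ge_iff) auto
  define sw where "sw = step_weight MT T m a q"
  have sw_nonneg: "sw x \<ge> 0" for x
    unfolding sw_def step_weight_def using a_nonneg by (intro sum_nonneg) auto
  have sw_meas [measurable]: "sw \<in> borel_measurable borel"
    unfolding sw_def step_weight_def[abs_def] by measurable
  have band: "(\<integral>x. x ^ i * indicator (level_band (cdf \<mu>) q k) x \<partial>\<mu>) = b k i * (q k - q (k - 1))"
    if "k \<in> {1..m}" for i k
  \<comment> \<open>Coordinate 0 of \<open>b\<close> is set to 1 instead of being a conditional
    expectation, so the mass of the band is computed directly.\<close>
  proof (cases "i = 0")
    case True
    have "measure \<mu> (level_band (cdf \<mu>) q k) = q k - q (k - 1)"
      unfolding level_band_def using q[OF that] by (intro \<mu>.measure_cdf_between[OF C]) auto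
    then show ?thesis using True by (simp add: assms(16))
  next
    case False
    then show ?thesis
      using cond_expect_event_quantile_band[OF assms(4,5) q[OF that], of i]
      by (simp add: assms(16) \<mu>_def)
  qed
  have T_int: "integrable MT (\<lambda>\<omega>. T \<omega> ^ i)" if "i \<le> r" for i
    using integrable_power_le[OF assms(4) T assms(11) that] .
  have moment: "(\<integral>x. sw x * x ^ i \<partial>\<mu>) = c i" if "i \<le> r" for i
  proof -
    have "(\<integral>x. sw x * x ^ i \<partial>\<mu>) =
        (\<Sum>k=1..m. a k * (\<integral>x. x ^ i * indicator (level_band (cdf \<mu>) q k) x \<partial>\<mu>))"
      unfolding sw_def \<mu>_def by (rule step_weight_integral(2)[where q=q, OF assms(4,5,13) T_int[OF that]])
    also have "\<dots> = (\<Sum>k=1..m. l k * b k i)"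
    proof (rule sum.cong[OF refl])
      fix k assume k: "k \<in> {1..m}"
      then show "a k * (\<integral>x. x ^ i * indicator (level_band (cdf \<mu>) q k) x \<partial>\<mu>) = l k * b k i"
        using q(2)[OF k] by (simp add: band[OF k] a_def)
    qed
    finally show ?thesis using l[OF that] by simp
  qed
  have moment_int: "integrable \<mu> (\<lambda>x. sw x * x ^ i)" if "i \<le> r" for i
    unfolding sw_def \<mu>_def by (rule step_weight_integral(1)[where q=q, OF assms(4,5,13) T_int[OF that]])
  \<comment> \<open>No normalising divisor appears because the mean weight is the moment of order 0,
    which is 1. The weighted variable is the identity on this law.\<close>
  define N where "N = density \<mu> (\<lambda>x. ennreal (sw x))"
  have sets_N: "sets N = sets borel" by (simp add: N_def)
  have N: "prob_space N"
  proof
    have "emeasure N (space N) = (\<integral>\<^sup>+ x. ennreal (sw x) \<partial>\<mu>)"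
      by (simp add: N_def emeasure_density)
    also have "\<dots> = ennreal (\<integral>x. sw x \<partial>\<mu>)"
      using moment_int[of 0] sw_nonneg by (intro nn_integral_eq_integral) auto
    finally show "emeasure N (space N) = 1"
      using moment[of 0] by (simp add: assms(12))
  qed
  have "(\<integral>\<omega>. sw (T \<omega>) \<partial>MT) = (\<integral>x. sw x \<partial>\<mu>)"
    unfolding \<mu>_def by (rule integral_distr[symmetric]) measurable
  then have "(\<integral>\<omega>. sw (T \<omega>) \<partial>MT) = 1"
    using moment[of 0] by (simp add: assms(12))
  then have "step_weighted_version MT T m a q N (\<lambda>x. x)"
    unfolding step_weighted_version_def sw_def[symmetric] \<mu>_def[symmetric]
    by (simp add: N_def distr_id2)
  moreover have "comonotonic_approximation n N (\<lambda>x. x)"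
    using assms(7) N
    by (intro comonotonic_approximation_density[of MYc n Yc "\<lambda>x. ennreal (sw x)"])
      (auto simp: comonotonic_modification_def N_def \<mu>_def assms(8))
  moreover have "integrable N (\<lambda>x. x ^ i) \<and> (\<integral>x. x ^ i \<partial>N) = (\<integral>\<omega>. S \<omega> ^ i \<partial>M)"
    if "i \<in> {1..r}" for i
    using that moment[of i] moment_int[of i] sw_nonneg
    by (simp add: N_def integrable_density integral_density assms(12))
  ultimately show ?thesis
    using a_Min a_Max N by blast
qed

end
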